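(* For any real numbers $\alpha,\beta\ge 0$ with $2\alpha+\beta>1$, there exist $\xi=\xi(\alpha,\beta)>0$ and $C=C(\alpha,\beta)>0$ such that the following holds. Let $G$ be an $n$-vertex graph with an edge coloring, and let $\mathcal{F}=(F_1,\dots,F_m)$ be the family of color classes. Suppose that: (i) each color class is non-empty; (ii) there exists $\mathcal{F}_M\subseteq\mathcal{F}$ with $|\mathcal{F}_M|\ge(\alpha-\xi)n$ such that each color class in $\mathcal{F}_M$ contains a matching of size two; (iii) there exists $\mathcal{F}_S\subseteq\mathcal{F}\setminus\mathcal{F}_M$ with $|\mathcal{F}_S|\ge(\beta-\xi)n$ such that each color class in $\mathcal{F}_S$ contains a star of size two; (iv) $|\mathcal{F}\setminus(\mathcal{F}_M\cup\mathcal{F}_S)|\ge(1-\alpha-\beta-\xi)n$. Then the rainbow girth of $G$ is at most $C\log n$.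
   Context: An edge coloring of a graph $G$ with $m$ colors is any map $\lambda:E(G)\to[m]$ (not necessarily proper); for $i\in[m]$ the set $\lambda^{-1}(i)$ is a color class. A subgraph of $G$ is rainbow if no two of its edges lie in the same color class. The rainbow girth of $G$ is the minimum length of a rainbow cycle in $G$ ($\infty$ if none exists). A star of size two is a pair of distinct edges sharing a vertex; a matching of size two is a pair of vertex-disjoint edges. *)

theory Defs
  imports Complex_Main "HOL-Library.Extended_Nat" "HOL-Library.Extended_Real"
begin

definition finite_simple_graph :: "'a set \<Rightarrow> 'a set set \<Rightarrow> bool" where
  "finite_simple_graph V E \<longleftrightarrow> finite V \<and> (\<forall>e\<in>E. e \<subseteq> V \<and> card e = 2)"

text \<open>Colorings need not be proper. Only the values of \<open>col\<close> on \<open>E\<close> matter.\<close>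

definition edge_coloring :: "'a set set \<Rightarrow> nat \<Rightarrow> ('a set \<Rightarrow> nat) \<Rightarrow> bool" where
  "edge_coloring E m col \<longleftrightarrow> (\<forall>e\<in>E. col e \<in> {1..m})"

definition color_class :: "'a set set \<Rightarrow> ('a set \<Rightarrow> nat) \<Rightarrow> nat \<Rightarrow> 'a set set" where
  "color_class E col i = {e \<in> E. col e = i}"

text \<open>The family of color classes is taken as a set of edge sets. Distinct color classes are
  disjoint, so when all of them are non-empty nothing is identified and cardinalities of
  subfamilies count colors.\<close>

definition color_classes :: "'a set set \<Rightarrow> nat \<Rightarrow> ('a set \<Rightarrow> nat) \<Rightarrow> 'a set set set" where
  "color_classes E m col = color_class E col ` {1..m}"

definition contains_matching_two :: "'a set set \<Rightarrow> bool" where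
  "contains_matching_two F \<longleftrightarrow> (\<exists>e\<in>F. \<exists>f\<in>F. e \<noteq> f \<and> e \<inter> f = {})"

definition contains_star_two :: "'a set set \<Rightarrow> bool" where
  "contains_star_two F \<longleftrightarrow> (\<exists>e\<in>F. \<exists>f\<in>F. e \<noteq> f \<and> e \<inter> f \<noteq> {})"

definition rainbow :: "('a set \<Rightarrow> nat) \<Rightarrow> 'a set set \<Rightarrow> bool" where
  "rainbow col H \<longleftrightarrow> (\<forall>e\<in>H. \<forall>f\<in>H. e \<noteq> f \<longrightarrow> col e \<noteq> col f)"

text \<open>A cycle is given by the list of its vertices in cyclic order, without repeating the
  first vertex at the end; its length is the length of the list.\<close>

definition cycle_edges :: "'a list \<Rightarrow> 'a set set" where
  "cycle_edges c = {{c ! i, c ! (Suc i mod length c)} | i. i < length c}"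

definition is_cycle :: "'a set set \<Rightarrow> 'a list \<Rightarrow> bool" where
  "is_cycle E c \<longleftrightarrow> 3 \<le> length c \<and> distinct c \<and> cycle_edges c \<subseteq> E"

text \<open>In \<open>enat\<close> the infimum of the empty set is \<open>\<infinity>\<close>.\<close>

definition rainbow_girth :: "'a set set \<Rightarrow> ('a set \<Rightarrow> nat) \<Rightarrow> enat" where
  "rainbow_girth E col = Inf {enat (length c) | c. is_cycle E c \<and> rainbow col (cycle_edges c)}"

end

theory Submission
  imports Defs
begin

text \<open>With more than \<open>(1 + \<xi>)n\<close> classes any rainbow selection is dense enough. Otherwise choose two
  disjoint edges from each class in \<open>M\<close>, two meeting edges from each class in \<open>S\<close>, and one edge,
  taken twice, from each other class. The intersections have at most \<open>2 - 2\<alpha> - \<beta> + 5\<xi>\<close> times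
  \<open>n\<close> vertices in total, so linearly many vertices lie in no intersection, and linearly many of
  those see boundedly many classes. Selecting one of the two edges of each class uniformly at
  random isolates each of these with probability bounded below. Some rainbow selection therefore
  has \<open>(1 - 3\<xi>)n\<close> edges on at most \<open>(1 - 4\<xi>)n\<close> vertices. A graph with \<open>(1 + \<epsilon>)N\<close> edges on \<open>N\<close>
  vertices has a cycle of length \<open>O(log N)\<close>: in a vertex-minimal such subgraph every set \<open>S\<close>
  meets at least \<open>(1 + \<epsilon>)|S|\<close> edges, so balls grow exponentially until a cycle closes.\<close>

section \<open>Walks, cycles and short cycles in dense graphs\<close>

definition edge_rel :: "'a set set \<Rightarrow> ('a \<times> 'a) set" where
  "edge_rel T = {(x, y). {x, y} \<in> T}"

lemma edge_rel_mono: "S \<subseteq> T \<Longrightarrow> edge_rel S \<subseteq> edge_rel T"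
  by (auto simp: edge_rel_def)

lemma relpow_edge_rel_sym: "(x, y) \<in> edge_rel T ^^ k \<Longrightarrow> (y, x) \<in> edge_rel T ^^ k"
proof (induction k arbitrary: y)
  case (Suc k)
  then obtain z where "(x, z) \<in> edge_rel T ^^ k" "(z, y) \<in> edge_rel T"
    by auto
  moreover from this have "(y, z) \<in> edge_rel T"
    by (simp add: edge_rel_def insert_commute)
  ultimately show ?case
    using Suc.IH relpow_Suc_I2 by metis
qed auto

lemma relpow_mono_set: "R \<subseteq> S \<Longrightarrow> R ^^ k \<subseteq> S ^^ k" for R S :: "('a \<times> 'a) set"
  by (induction k) (auto simp: relcomp_mono)

text \<open>A shortest walk from \<open>x\<close> to \<open>y\<close> in \<open>T\<close> is a path,
  since a repeated vertex would allow the part between its two visits to be cut out. The edge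
  \<open>{x, y}\<close> then closes this path.\<close>

lemma cycle_from_walk:
  assumes xy: "{x, y} \<in> E" "x \<noteq> y" and T: "T \<subseteq> E" "{x, y} \<notin> T"
    and walk: "(x, y) \<in> edge_rel T ^^ k"
  shows "\<exists>c. is_cycle E c \<and> length c \<le> Suc k"
proof -
  define m where "m = (LEAST j. (x, y) \<in> edge_rel T ^^ j)"
  have m: "(x, y) \<in> edge_rel T ^^ m" and min: "\<And>j. (x, y) \<in> edge_rel T ^^ j \<Longrightarrow> m \<le> j"
    unfolding m_def using walk by (auto intro: LeastI Least_le)
  obtain f where f: "f 0 = x" "f m = y" "\<And>i. i < m \<Longrightarrow> (f i, f (Suc i)) \<in> edge_rel T"
    using m unfolding relpow_fun_conv by auto
  have sub: "(f i, f (i + d)) \<in> edge_rel T ^^ d" if "i + d \<le> m" for i d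
    unfolding relpow_fun_conv by (rule exI[of _ "\<lambda>j. f (i + j)"]) (use f that in auto)
  have inj: "f i \<noteq> f j" if "i < j" "j \<le> m" for i j
  proof
    assume eq: "f i = f j"
    have "(x, f i) \<in> edge_rel T ^^ i" "(f j, y) \<in> edge_rel T ^^ (m - j)"
      using sub[of 0 i] sub[of j "m - j"] that f by auto
    then have "(x, y) \<in> edge_rel T ^^ (i + (m - j))"
      using eq by (auto simp: relpow_add)
    from min[OF this] show False using that by simp
  qed
  \<comment> \<open>Length 0 is excluded by \<open>x \<noteq> y\<close> and length 1 by
    \<open>{x, y} \<notin> T\<close>, so the closed path has at least three vertices.\<close>
  have "m \<noteq> 0" using f(1,2) xy(2) by (intro notI) simp
  moreover have "m \<noteq> 1" using f T by (auto simp: edge_rel_def)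
  ultimately have m2: "m \<ge> 2" by simp
  let ?c = "map f [0..<Suc m]"
  have "distinct ?c"
    unfolding distinct_map by (auto simp: inj_on_def simp del: upt_Suc) (metis inj less_Suc_eq_le linorder_neqE_nat)
  moreover have "cycle_edges ?c \<subseteq> E"
  proof
    fix e assume "e \<in> cycle_edges ?c"
    then obtain i where i: "i < Suc m" "e = {?c ! i, ?c ! (Suc i mod Suc m)}"
      by (auto simp: cycle_edges_def simp del: upt_Suc)
    show "e \<in> E"
    proof (cases "i = m")
      case True
      then have "e = {y, x}" using i f by (simp del: upt_Suc)
      then show ?thesis using xy by (simp add: insert_commute)
    next
      case False
      then have "i < m" using i by simp
      then have "e = {f i, f (Suc i)}" using i by (simp del: upt_Suc)
      then show ?thesis using f(3)[OF \<open>i < m\<close>] T by (auto simp: edge_rel_def)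
    qed
  qed
  ultimately have "is_cycle E ?c" using m2 by (simp add: is_cycle_def)
  moreover have "length ?c \<le> Suc k" using min[OF walk] by simp
  ultimately show ?thesis by blast
qed

text \<open>Balls around \<open>v\<close> together with a breadth-first tree: an edge meeting the ball that is
  missing from the next tree closes a short cycle; otherwise the next ball, which has more
  vertices than the tree has edges, is larger by the expansion factor.\<close>

lemma ball_growth:
  assumes fin: "finite E" and two: "\<And>e. e \<in> E \<Longrightarrow> e \<subseteq> W \<and> card e = 2"
    and W: "finite W" "v \<in> W" and r: "r \<ge> (0::real)"
    and expand: "\<And>S. S \<subseteq> W \<Longrightarrow> S \<noteq> {} \<Longrightarrow> r * card S \<le> card {e \<in> E. e \<inter> S \<noteq> {}}"
  shows "(\<exists>c. is_cycle E c \<and> length c \<le> 2 * k + 1) \<or>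
    (\<exists>B T. B \<subseteq> W \<and> v \<in> B \<and> T \<subseteq> E \<and> card T < card B \<and>
      (\<forall>x\<in>B. \<exists>j\<le>k. (x, v) \<in> edge_rel T ^^ j) \<and> r ^ k \<le> card B)"
proof (induction k)
  case 0
  have "\<exists>j\<le>0. (v, v) \<in> edge_rel {} ^^ j" by auto
  then show ?case using W by (intro disjI2 exI[of _ "{v}"] exI[of _ "{}"]) auto
next
  case (Suc k)
  show ?case
  proof (cases "\<exists>c. is_cycle E c \<and> length c \<le> 2 * Suc k + 1")
    case False
    then have "\<not> (\<exists>c. is_cycle E c \<and> length c \<le> 2 * k + 1)" by fastforce
    with Suc obtain B T where B: "B \<subseteq> W" "v \<in> B" "T \<subseteq> E" "card T < card B"
      "\<forall>x\<in>B. \<exists>j\<le>k. (x, v) \<in> edge_rel T ^^ j" "r ^ k \<le> card B" by blast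
    define F where "F = {e \<in> E. e \<inter> B \<noteq> {}}"
    define B' where "B' = B \<union> \<Union>F"
    have B'W: "B' \<subseteq> W" using B(1) two by (auto simp: B'_def F_def)
    have finB': "finite B'" using B'W W finite_subset by blast
    have "\<exists>u. u \<in> B \<and> {w, u} \<in> E" if w: "w \<in> B' - B" for w
    proof -
      obtain e where e: "e \<in> E" "e \<inter> B \<noteq> {}" "w \<in> e" using w by (auto simp: B'_def F_def)
      then obtain u where "u \<in> e" "u \<in> B" by auto
      moreover have "w \<noteq> u" using w \<open>u \<in> B\<close> by auto
      moreover have "card e = 2" using e two by auto
      ultimately have "e = {w, u}" using e(3) by (auto simp: card_2_iff)
      then show ?thesis using e \<open>u \<in> B\<close> by auto
    qed
    then obtain p where p: "\<And>w. w \<in> B' - B \<Longrightarrow> p w \<in> B \<and> {w, p w} \<in> E" by metis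
    \<comment> \<open>One parent edge per new vertex: the tree gains at most as many edges as the
      ball gains vertices, which preserves the strict inequality between their sizes.\<close>
    define T' where "T' = T \<union> (\<lambda>w. {w, p w}) ` (B' - B)"
    have T'E: "T' \<subseteq> E" using B p by (auto simp: T'_def)
    have "card T' \<le> card T + card ((\<lambda>w. {w, p w}) ` (B' - B))"
      unfolding T'_def by (rule card_Un_le)
    also have "\<dots> \<le> card T + card (B' - B)"
      using finB' by (intro add_left_mono card_image_le) simp
    finally have "card T' \<le> card T + card (B' - B)" .
    moreover have "card (B' - B) = card B' - card B" "card B \<le> card B'"
      using finB' by (auto simp: B'_def card_Diff_subset intro!: card_mono)
    ultimately have cT': "card T' < card B'" using B(4) by linarith
    have walk: "\<exists>j\<le>Suc k. (x, v) \<in> edge_rel T' ^^ j" if "x \<in> B'" for x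
    proof -
      have mono: "edge_rel T ^^ j \<subseteq> edge_rel T' ^^ j" for j
        by (intro relpow_mono_set edge_rel_mono) (auto simp: T'_def)
      show ?thesis
      proof (cases "x \<in> B")
        case True
        then show ?thesis using B(5) mono le_SucI by blast
      next
        case False
        then have x: "x \<in> B' - B" using that by simp
        then obtain j where "j \<le> k" "(p x, v) \<in> edge_rel T' ^^ j"
          using B(5) p mono by blast
        moreover have "(x, p x) \<in> edge_rel T'" using x by (auto simp: edge_rel_def T'_def)
        ultimately have "Suc j \<le> Suc k" "(x, v) \<in> edge_rel T' ^^ Suc j"
          by (auto intro: relpow_Suc_I2 simp del: relpow.simps)
        then show ?thesis by blast
      qed
    qed
    \<comment> \<open>Both ends of an edge meeting \<open>B\<close> lie in \<open>B'\<close>, and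
      walks through \<open>v\<close> join them in at most \<open>2 * Suc k\<close> steps of
      \<open>T'\<close>. Outside \<open>T'\<close> such an edge would close a cycle of a length
      excluded in this case.\<close>
    have "F \<subseteq> T'"
    proof
      fix e assume e: "e \<in> F"
      then have "card e = 2" and eE: "e \<in> E" using two by (auto simp: F_def)
      then obtain x y where xy: "e = {x, y}" "x \<noteq> y" by (auto simp: card_2_iff)
      then have "x \<in> B'" "y \<in> B'" using e by (auto simp: B'_def)
      then obtain i j where i: "i \<le> Suc k" "(x, v) \<in> edge_rel T' ^^ i"
        and j: "j \<le> Suc k" "(y, v) \<in> edge_rel T' ^^ j" using walk by metis
      have "(x, y) \<in> edge_rel T' ^^ (i + j)"
        using i(2) relpow_edge_rel_sym[OF j(2)] by (metis relcompI relpow_add)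
      moreover have "\<not> (\<exists>c. is_cycle E c \<and> length c \<le> Suc (i + j))"
      proof -
        have "Suc (i + j) \<le> 2 * Suc k + 1" using i(1) j(1) by simp
        then show ?thesis using False le_trans by blast
      qed
      ultimately show "e \<in> T'"
        using cycle_from_walk[OF _ xy(2) T'E, of "i + j"] eE xy(1) by blast
    qed
    then have "card F \<le> card T'"
      using T'E fin by (intro card_mono) (auto intro: finite_subset)
    have "r ^ Suc k \<le> r * card B" using B(6) r by (simp add: mult_left_mono)
    also have "\<dots> \<le> card F" unfolding F_def using B by (intro expand) auto
    also have "\<dots> \<le> card B'" using \<open>card F \<le> card T'\<close> cT' by simp
    finally have "r ^ Suc k \<le> card B'" .
    moreover have "v \<in> B'" using B by (auto simp: B'_def)
    ultimately show ?thesis using B'W T'E cT' walk by (intro disjI2 exI[of _ B'] exI[of _ T']) simp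
  qed simp
qed

lemma is_cycle_mono: "is_cycle E c \<Longrightarrow> E \<subseteq> E' \<Longrightarrow> is_cycle E' c"
  by (auto simp: is_cycle_def)

text \<open>In a smallest vertex set \<open>W\<close> of the required density, deleting
  \<open>S\<close> must destroy at least \<open>(1 + \<epsilon>) * card S\<close> edges, as
  otherwise the rest would still be dense. This is the expansion that \<open>ball_growth\<close>
  consumes.\<close>

lemma dense_graph_short_cycle:
  fixes \<epsilon> :: real
  assumes V: "finite_simple_graph V E" "V \<noteq> {}" and \<epsilon>: "\<epsilon> > 0"
    and dense: "card E \<ge> (1 + \<epsilon>) * card V"
  shows "\<exists>c. is_cycle E c \<and> length c \<le> 2 * ln (card V) / ln (1 + \<epsilon>) + 3"
proof -
  have finV: "finite V" and E: "\<And>e. e \<in> E \<Longrightarrow> e \<subseteq> V \<and> card e = 2"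
    using V by (auto simp: finite_simple_graph_def)
  have finE: "finite E" using finV E by (intro finite_subset[of E "Pow V"]) auto
  define P where "P W \<longleftrightarrow> W \<subseteq> V \<and> W \<noteq> {} \<and> card {e \<in> E. e \<subseteq> W} \<ge> (1 + \<epsilon>) * card W" for W
  have "{e \<in> E. e \<subseteq> V} = E" using E by auto
  then have "P V" using V dense by (simp add: P_def)
  then obtain W where "P W" and min: "\<And>U. P U \<Longrightarrow> card W \<le> card U"
    using ex_has_least_nat[of P V card] by auto
  then have W: "W \<subseteq> V" "W \<noteq> {}" "card {e \<in> E. e \<subseteq> W} \<ge> (1 + \<epsilon>) * card W"
    by (auto simp: P_def)
  have finW: "finite W" using W finV finite_subset by blast
  define E' where "E' = {e \<in> E. e \<subseteq> W}"
  have finE': "finite E'" using finE by (simp add: E'_def)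
  have expand: "(1 + \<epsilon>) * card S \<le> card {e \<in> E'. e \<inter> S \<noteq> {}}" if S: "S \<subseteq> W" "S \<noteq> {}" for S
  proof (cases "S = W")
    case True
    \<comment> \<open>Here \<open>W - S\<close> is empty and minimality says nothing, but every edge
      inside \<open>W\<close> meets \<open>W\<close>.\<close>
    have "e \<inter> W \<noteq> {}" if "e \<in> E'" for e
      using that E by (fastforce simp: E'_def card_2_iff)
    then have "{e \<in> E'. e \<inter> S \<noteq> {}} = E'" using True by auto
    then show ?thesis using True W by (simp add: E'_def)
  next
    case False
    have less: "card S \<le> card W" "card S > 0" using S finW by (auto intro: card_mono simp: card_gt_0_iff finite_subset)
    have cd: "card (W - S) = card W - card S" using S finW by (simp add: card_Diff_subset finite_subset)
    then have "\<not> P (W - S)" using min[of "W - S"] less by linarith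
    moreover have "{e \<in> E. e \<subseteq> W - S} = E' - {e \<in> E'. e \<inter> S \<noteq> {}}" by (auto simp: E'_def)
    ultimately have "card (E' - {e \<in> E'. e \<inter> S \<noteq> {}}) < (1 + \<epsilon>) * card (W - S)"
      using W S False by (auto simp: P_def)
    moreover have "card (E' - {e \<in> E'. e \<inter> S \<noteq> {}}) = card E' - card {e \<in> E'. e \<inter> S \<noteq> {}}"
      using finE' by (intro card_Diff_subset) auto
    moreover have "card {e \<in> E'. e \<inter> S \<noteq> {}} \<le> card E'" using finE' by (intro card_mono) auto
    ultimately have "real (card E') - card {e \<in> E'. e \<inter> S \<noteq> {}} < (1 + \<epsilon>) * (real (card W) - card S)"
      using less cd by (simp add: of_nat_diff)
    then show ?thesis using W(3) by (simp add: E'_def[symmetric] algebra_simps)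
  qed
  \<comment> \<open>Large enough that \<open>(1 + \<epsilon>) ^ k\<close> exceeds
    \<open>card W\<close>, so the ball alternative of \<open>ball_growth\<close> is impossible. As
    \<open>k\<close> is at most one above the quotient of logarithms, \<open>2 * k + 1\<close>
    produces the summand 3.\<close>
  define k where "k = nat \<lfloor>ln (card W) / ln (1 + \<epsilon>)\<rfloor> + 1"
  obtain v where "v \<in> W" using W by auto
  have ln0: "ln (1 + \<epsilon>) > 0" using \<epsilon> by simp
  have cW: "card W > 0" using W finW by (simp add: card_gt_0_iff)
  have kgt: "k > ln (card W) / ln (1 + \<epsilon>)" unfolding k_def by linarith
  then have "ln (real (card W)) < ln ((1 + \<epsilon>) ^ k)"
    using ln0 \<epsilon> by (simp add: pos_divide_less_eq ln_realpow)
  then have "real (card W) < (1 + \<epsilon>) ^ k" using cW \<epsilon> by (simp add: ln_less_cancel_iff)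
  then have no: "\<not> (1 + \<epsilon>) ^ k \<le> card B" if "B \<subseteq> W" for B
    using card_mono[OF finW that] by linarith
  obtain c where c: "is_cycle E' c" "length c \<le> 2 * k + 1"
    using ball_growth[OF finE' _ finW \<open>v \<in> W\<close> _ expand, of k] E no \<epsilon> by (auto simp: E'_def)
  have "ln (card W) \<ge> 0" using cW by simp
  then have "real k \<le> ln (card W) / ln (1 + \<epsilon>) + 1"
    unfolding k_def using ln0 by (simp add: of_nat_nat)
  also have "\<dots> \<le> ln (card V) / ln (1 + \<epsilon>) + 1"
    using ln0 cW card_mono[OF finV W(1)] by (simp add: divide_right_mono)
  finally have "real (length c) \<le> 2 * ln (card V) / ln (1 + \<epsilon>) + 3" using c(2) by linarith
  moreover have "is_cycle E c" using c by (auto intro: is_cycle_mono simp: E'_def)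
  ultimately show ?thesis by blast
qed

section \<open>Selecting one edge from each class\<close>

text \<open>The random selection is carried out by counting: \<open>T\<close> is the set of classes
  that choose \<open>a\<close> instead of \<open>b\<close>. Only the at most \<open>D\<close>
  classes seeing \<open>v\<close> constrain a selection that avoids \<open>v\<close>, and each of
  them has an edge missing \<open>v\<close>. Hence at least a fraction \<open>1 / 2 ^ D\<close> of
  all \<open>T\<close> avoid \<open>v\<close>, and double counting the pairs of \<open>v\<close> and
  \<open>T\<close> gives a good \<open>T\<close>.\<close>

lemma exists_selection_avoiding:
  fixes a b :: "'c \<Rightarrow> 'a set"
  assumes C: "finite C" and L: "finite L"
    and disj: "\<And>v F. v \<in> L \<Longrightarrow> F \<in> C \<Longrightarrow> v \<notin> a F \<inter> b F"
    and deg: "\<And>v. v \<in> L \<Longrightarrow> card {F \<in> C. v \<in> a F \<union> b F} \<le> D"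
  shows "\<exists>T. card L \<le> 2 ^ D * card {v \<in> L. \<forall>F\<in>C. v \<notin> (if F \<in> T then a F else b F)}"
proof (rule ccontr)
  define I where "I T = {v \<in> L. \<forall>F\<in>C. v \<notin> (if F \<in> T then a F else b F)}" for T
  assume "\<nexists>T. card L \<le> 2 ^ D * card {v \<in> L. \<forall>F\<in>C. v \<notin> (if F \<in> T then a F else b F)}"
  then have lt: "2 ^ D * card (I T) < card L" for T by (auto simp: I_def not_le)
  have ge: "2 ^ card C \<le> 2 ^ D * card {T \<in> Pow C. v \<in> I T}" if v: "v \<in> L" for v
  proof -
    \<comment> \<open>Classes outside \<open>?N\<close> choose freely. Inside \<open>?N\<close> the
      choice is forced: take \<open>a\<close> exactly where \<open>b\<close> contains
      \<open>v\<close>, which is safe because \<open>v\<close> is never in both.\<close>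
    let ?N = "{F \<in> C. v \<in> a F \<union> b F}" and ?P = "{F \<in> C. v \<in> b F}"
    have "inj_on (\<lambda>T. T \<union> ?P) (Pow (C - ?N))" by (rule inj_onI) blast
    then have "card (Pow (C - ?N)) \<le> card {T \<in> Pow C. v \<in> I T}"
    proof (rule card_inj_on_le)
      show "(\<lambda>T. T \<union> ?P) ` Pow (C - ?N) \<subseteq> {T \<in> Pow C. v \<in> I T}"
        using v disj by (auto simp: I_def)
    qed (use C in auto)
    then have "2 ^ (card C - card ?N) \<le> card {T \<in> Pow C. v \<in> I T}"
      using C by (simp add: card_Pow card_Diff_subset)
    then have "2 ^ D * 2 ^ (card C - card ?N) \<le> 2 ^ D * card {T \<in> Pow C. v \<in> I T}"
      by (rule mult_left_mono) simp
    moreover have "(2::nat) ^ card C \<le> 2 ^ (D + (card C - card ?N))"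
      using deg[OF v] by (intro power_increasing) auto
    ultimately show ?thesis unfolding power_add by (rule le_trans[rotated])
  qed
  have "card L * 2 ^ card C = (\<Sum>v\<in>L. 2 ^ card C)" by simp
  also have "\<dots> \<le> (\<Sum>v\<in>L. 2 ^ D * card {T \<in> Pow C. v \<in> I T})"
    by (intro sum_mono ge)
  also have "\<dots> = 2 ^ D * (\<Sum>v\<in>L. card {T \<in> Pow C. v \<in> I T})"
    by (simp add: sum_distrib_left)
  also have "(\<Sum>v\<in>L. card {T \<in> Pow C. v \<in> I T}) = (\<Sum>T\<in>Pow C. card (I T))"
  proof (rule sum_multicount_gen)
    have "{v \<in> L. v \<in> I T} = I T" for T by (auto simp: I_def)
    then show "\<forall>T\<in>Pow C. card {v \<in> L. v \<in> I T} = card (I T)" by simp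
  qed (use C L in auto)
  also have "2 ^ D * \<dots> = (\<Sum>T\<in>Pow C. 2 ^ D * card (I T))" by (simp add: sum_distrib_left)
  also have "\<dots> < (\<Sum>T\<in>Pow C. card L)"
    using C lt by (intro sum_strict_mono) auto
  also have "\<dots> = card L * 2 ^ card C" using C by (simp add: card_Pow)
  finally show False by simp
qed

text \<open>The color of \<open>g F\<close> determines \<open>F\<close>. So the selected edges are
  rainbow and there are \<open>card C\<close> of them, which makes them a dense graph on
  \<open>V'\<close>.\<close>

lemma rainbow_cycle_from_selection:
  fixes \<epsilon> :: real
  assumes G: "finite_simple_graph V E" and V': "V' \<subseteq> V" and \<epsilon>: "\<epsilon> > 0"
    and C: "C \<subseteq> color_classes E m col" "C \<noteq> {}" "finite C"
    and g: "\<And>F. F \<in> C \<Longrightarrow> g F \<in> F \<and> g F \<subseteq> V'"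
    and dense: "card C \<ge> (1 + \<epsilon>) * card V'"
  shows "\<exists>c. is_cycle E c \<and> rainbow col (cycle_edges c) \<and>
    length c \<le> 2 * ln (card V) / ln (1 + \<epsilon>) + 3"
proof -
  have gE: "g F \<in> E" and class_eq: "color_class E col (col (g F)) = F" if F: "F \<in> C" for F
  proof -
    obtain i where "F = color_class E col i" using F C(1) by (auto simp: color_classes_def)
    with g[OF F] show "g F \<in> E" "color_class E col (col (g F)) = F"
      by (simp_all add: color_class_def)
  qed
  have inj: "F = F'" if "F \<in> C" "F' \<in> C" "col (g F) = col (g F')" for F F'
    by (metis class_eq that)
  then have "inj_on g C" by (intro inj_onI inj) simp_all
  then have card: "card (g ` C) = card C" by (simp add: card_image)
  have finV: "finite V" using G by (simp add: finite_simple_graph_def)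
  then have finV': "finite V'" using V' finite_subset by blast
  have G': "finite_simple_graph V' (g ` C)"
    using G gE g finV' by (auto simp: finite_simple_graph_def)
  obtain F where "F \<in> C" using C by auto
  then have "card (g F) = 2" "g F \<subseteq> V'"
    using G gE[of F] g[of F] by (auto simp: finite_simple_graph_def)
  then have "V' \<noteq> {}" by auto
  then obtain c where c: "is_cycle (g ` C) c" "length c \<le> 2 * ln (card V') / ln (1 + \<epsilon>) + 3"
    using dense_graph_short_cycle[OF G' _ \<epsilon>] dense unfolding card by blast
  have "card V' > 0" using \<open>V' \<noteq> {}\<close> finV' by (simp add: card_gt_0_iff)
  then have "ln (card V') / ln (1 + \<epsilon>) \<le> ln (card V) / ln (1 + \<epsilon>)"
    using \<epsilon> card_mono[OF finV V'] by (simp add: divide_right_mono)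
  then have "length c \<le> 2 * ln (card V) / ln (1 + \<epsilon>) + 3" using c(2) by linarith
  moreover have "is_cycle E c" using gE by (intro is_cycle_mono[OF c(1)]) blast
  moreover have "rainbow col (g ` C)"
    unfolding rainbow_def by (intro ballI impI notI) (metis imageE inj)
  then have "rainbow col (cycle_edges c)"
    using c(1) unfolding rainbow_def is_cycle_def by (meson subsetD)
  ultimately show ?thesis by blast
qed

lemma sum_degree_le:
  assumes "finite C" "finite L" "\<And>F. F \<in> C \<Longrightarrow> finite (U F) \<and> card (U F) \<le> k"
  shows "(\<Sum>v\<in>L. card {F \<in> C. v \<in> U F}) \<le> k * card C"
proof -
  have "(\<Sum>v\<in>L. card {F \<in> C. v \<in> U F}) = (\<Sum>F\<in>C. card {v \<in> L. v \<in> U F})"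
    using assms by (intro sum_multicount_gen) auto
  also have "\<dots> \<le> (\<Sum>F\<in>C. k)"
  proof (rule sum_mono)
    fix F assume "F \<in> C"
    then have "card {v \<in> L. v \<in> U F} \<le> card (U F)" using assms by (intro card_mono) auto
    then show "card {v \<in> L. v \<in> U F} \<le> k" using assms \<open>F \<in> C\<close> by force
  qed
  finally show ?thesis by (simp add: mult.commute)
qed

text \<open>The set \<open>I\<close> can be deleted from the graph without losing a selected edge.
  Every selection covers the vertices in \<open>K\<close>. Outside \<open>K\<close>, at most
  \<open>\<delta> * card V\<close> vertices see more than \<open>D\<close> classes, so at least
  \<open>\<delta> * card V\<close> remain for \<open>exists_selection_avoiding\<close>.\<close>

lemma exists_selection_missing_vertices:
  fixes a b :: "'c \<Rightarrow> 'a set" and \<delta> :: real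
  assumes V: "finite V" and C: "finite C" "card C \<le> 2 * card V"
    and two: "\<And>F. F \<in> C \<Longrightarrow> card (a F) = 2 \<and> card (b F) = 2"
    and shared: "(\<Sum>F\<in>C. card (a F \<inter> b F)) \<le> (1 - 2 * \<delta>) * card V"
    and D: "\<delta> * D \<ge> 8" and \<delta>: "\<delta> > 0"
  shows "\<exists>T I. I \<subseteq> V \<and> \<delta> * card V \<le> 2 ^ D * card I \<and>
    (\<forall>F\<in>C. (if F \<in> T then a F else b F) \<inter> I = {})"
proof -
  define K where "K = (\<Union>F\<in>C. a F \<inter> b F)"
  define d where "d v = card {F \<in> C. v \<in> a F \<union> b F}" for v
  define L where "L = {v \<in> V - K. d v \<le> D}"
  define H where "H = {v \<in> V - K. \<not> d v \<le> D}"
  have fin: "finite (a F)" "finite (b F)" if "F \<in> C" for F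
    using two[OF that] by (auto intro: card_ge_0_finite)
  have "D > 0" using D by (auto intro: Nat.gr0I)
  have "card K \<le> (\<Sum>F\<in>C. card (a F \<inter> b F))" unfolding K_def by (rule card_UN_le) (use C in auto)
  then have K: "card K \<le> (1 - 2 * \<delta>) * card V" using shared by linarith
  have finK: "finite K" using C fin by (auto simp: K_def)
  have VK: "card V \<le> card (V - K) + card K"
    by (metis add.commute diff_card_le_card_Diff finK le_diff_conv)
  have "card (V - K) = card L + card H"
    unfolding L_def H_def using V by (subst card_Un_disjoint[symmetric]) (auto intro: arg_cong[of _ _ card])
  \<comment> \<open>Each class touches at most 4 vertices and there are at most
    \<open>2 * card V\<close> classes. This is the origin of the 8 in the condition on
    \<open>D\<close>.\<close>
  moreover have "D * card H \<le> 8 * card V"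
  proof -
    have "D * card H = (\<Sum>v\<in>H. D)" by simp
    also have "\<dots> \<le> (\<Sum>v\<in>H. d v)" by (rule sum_mono) (auto simp: H_def)
    also have "\<dots> \<le> 4 * card C" unfolding d_def
    proof (rule sum_degree_le)
      show "finite (a F \<union> b F) \<and> card (a F \<union> b F) \<le> 4" if "F \<in> C" for F
        using card_Un_le[of "a F" "b F"] two[OF that] fin[OF that] by simp
    qed (use C V in \<open>auto simp: H_def\<close>)
    finally show ?thesis using C by linarith
  qed
  then have "D * real (card H) \<le> D * (\<delta> * card V)"
  proof -
    assume "D * card H \<le> 8 * card V"
    then have "real (D * card H) \<le> real (8 * card V)" by (rule of_nat_mono)
    also have "\<dots> \<le> \<delta> * D * card V" using D by (simp add: mult_right_mono)
    finally show ?thesis by (simp add: mult_ac)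
  qed
  then have "card H \<le> \<delta> * card V" using \<open>D > 0\<close> by simp
  ultimately have L: "\<delta> * card V \<le> card L" using K VK by (simp add: algebra_simps)
  define I where "I T = {v \<in> L. \<forall>F\<in>C. v \<notin> (if F \<in> T then a F else b F)}" for T
  obtain T where "card L \<le> 2 ^ D * card (I T)"
    using exists_selection_avoiding[of C L a b D] C V
    by (auto simp: I_def L_def K_def d_def)
  then have "real (card L) \<le> real (2 ^ D * card (I T))" by (rule of_nat_mono)
  then have "\<delta> * card V \<le> 2 ^ D * card (I T)" using L by simp
  moreover have "I T \<subseteq> V" by (auto simp: I_def L_def)
  moreover have "\<forall>F\<in>C. (if F \<in> T then a F else b F) \<inter> I T = {}" by (auto simp: I_def)
  ultimately show ?thesis by blast
qed

section \<open>From the hypotheses on the classes to a rainbow cycle\<close>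

text \<open>The bound on \<open>5 * \<xi>\<close> leaves a linear number of vertices outside all
  intersections. The bound on \<open>4 * \<xi> * 2 ^ D\<close> makes the missed set \<open>I\<close>
  have at least \<open>4 * \<xi> * card V\<close> vertices, which outweighs the possible deficit of
  \<open>3 * \<xi> * card V\<close> classes.\<close>

lemma rainbow_cycle_exists:
  fixes \<xi> \<eta> \<alpha> \<beta> :: real
  assumes G: "finite_simple_graph V E" and V: "V \<noteq> {}"
    and ne: "\<forall>F \<in> color_classes E m col. F \<noteq> {}"
    and M: "M \<subseteq> color_classes E m col" "card M \<ge> (\<alpha> - \<xi>) * card V"
      "\<forall>F\<in>M. contains_matching_two F"
    and S: "S \<subseteq> color_classes E m col - M" "card S \<ge> (\<beta> - \<xi>) * card V"
      "\<forall>F\<in>S. contains_star_two F"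
    and R: "card (color_classes E m col - (M \<union> S)) \<ge> (1 - \<alpha> - \<beta> - \<xi>) * card V"
    and \<xi>: "\<xi> > 0" "\<xi> \<le> 1 / 4" "5 * \<xi> \<le> 2 * \<alpha> + \<beta> - 1 - 2 * \<delta>" "4 * \<xi> * 2 ^ D \<le> \<delta>"
    and D: "\<delta> * D \<ge> 8"
  shows "\<exists>c. is_cycle E c \<and> rainbow col (cycle_edges c) \<and>
    length c \<le> 2 * ln (card V) / ln (1 + \<xi>) + 3"
proof -
  define C where "C = color_classes E m col"
  have finC: "finite C" by (simp add: C_def color_classes_def)
  have finV: "finite V" using G by (simp add: finite_simple_graph_def)
  then have cV: "card V > 0" using V by (simp add: card_gt_0_iff)
  have \<delta>: "\<delta> > 0" using \<xi> by (meson less_le_trans mult_pos_pos zero_less_numeral zero_less_power)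
  have edge: "e \<subseteq> V \<and> card e = 2" if "F \<in> C" "e \<in> F" for e F
    using that G by (auto simp: C_def color_classes_def color_class_def finite_simple_graph_def)
  have MSC: "M \<subseteq> C" "S \<subseteq> C" "M \<inter> S = {}" using M S by (auto simp: C_def)
  have finMS: "finite M" "finite S" using MSC finC by (auto intro: finite_subset)
  have cC: "card C = card M + card S + card (C - (M \<union> S))"
    using MSC finMS card_mono[of C "M \<union> S"] finC by (simp add: card_Diff_subset card_Un_disjoint)
  have "real (card C) \<ge> (\<alpha> - \<xi>) * card V + (\<beta> - \<xi>) * card V + (1 - \<alpha> - \<beta> - \<xi>) * card V"
    using M S R cC by (simp add: C_def)
  then have C_ge: "card C \<ge> (1 - 3 * \<xi>) * card V" by (simp add: algebra_simps)
  have "(1 - 3 * \<xi>) * card V > 0" using \<xi> cV by simp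
  then have "card C > 0" using C_ge by linarith
  then have C0: "C \<noteq> {}" by auto
  \<comment> \<open>The permitted overlap of the two edges: 0 for a matching, 1 for a star, 2 for a
    single edge taken twice.\<close>
  define w where "w F = (if F \<in> M then 0 else if F \<in> S then 1 else 2 :: nat)" for F
  have "\<exists>a b. a \<in> F \<and> b \<in> F \<and> card (a \<inter> b) \<le> w F" if F: "F \<in> C" for F
  proof (cases "F \<in> M \<or> F \<in> S")
    case True
    then consider "F \<in> M" | "F \<in> S" "F \<notin> M" by blast
    then show ?thesis
    proof cases
      case 1
      then have "contains_matching_two F" using M by blast
      then obtain a b where "a \<in> F" "b \<in> F" "a \<inter> b = {}" by (auto simp: contains_matching_two_def)
      then show ?thesis by (metis card.empty le0)
    next
      case 2
      then have "contains_star_two F" using S by blast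
      then obtain a b where ab: "a \<in> F" "b \<in> F" "a \<noteq> b" by (auto simp: contains_star_two_def)
      then have card: "card a = 2" "card b = 2" using edge F by auto
      have "a \<inter> b \<subset> a"
      proof (rule psubsetI)
        show "a \<inter> b \<noteq> a"
        proof
          assume "a \<inter> b = a"
          then have "a \<subseteq> b" by blast
          moreover have "finite b" using card by (intro card_ge_0_finite) simp
          ultimately show False using card_subset_eq[of b a] card ab by simp
        qed
      qed simp
      moreover have "finite a" using card by (intro card_ge_0_finite) simp
      ultimately have "card (a \<inter> b) < 2" using psubset_card_mono[of a "a \<inter> b"] card by simp
      then show ?thesis using ab 2 by (intro exI[of _ a] exI[of _ b]) (auto simp: w_def)
    qed
  next
    case False
    obtain e where "e \<in> F" using ne F by (auto simp: C_def)
    then show ?thesis using False edge F by (intro exI[of _ e]) (auto simp: w_def)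
  qed
  then obtain a b where ab: "\<And>F. F \<in> C \<Longrightarrow> a F \<in> F \<and> b F \<in> F \<and> card (a F \<inter> b F) \<le> w F" by metis
  show ?thesis
  proof (cases "card C \<ge> (1 + \<xi>) * card V")
    case True
    \<comment> \<open>With this many classes, selecting \<open>a\<close> everywhere is already dense
      on all of \<open>V\<close>.\<close>
    then show ?thesis
      using ab edge finC C0 \<xi>
      by (intro rainbow_cycle_from_selection[OF G order_refl, of _ C m col a]) (auto simp: C_def)
  next
    case False
    have "(\<Sum>F\<in>C. card (a F \<inter> b F)) \<le> (\<Sum>F\<in>C. w F)" using ab by (intro sum_mono) auto
    also have "(\<Sum>F\<in>C. w F) = (\<Sum>F\<in>C - (M \<union> S). w F) + ((\<Sum>F\<in>M. w F) + (\<Sum>F\<in>S. w F))"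
      using MSC finC finMS
      by (subst sum.subset_diff[of "M \<union> S"]) (auto simp: sum.union_disjoint)
    also have "(\<Sum>F\<in>M. w F) = 0" by (simp add: w_def)
    also have "(\<Sum>F\<in>S. w F) = (\<Sum>F\<in>S. 1)" using MSC by (intro sum.cong) (auto simp: w_def)
    also have "(\<Sum>F\<in>C - (M \<union> S). w F) = (\<Sum>F\<in>C - (M \<union> S). 2)" by (intro sum.cong) (auto simp: w_def)
    finally have "(\<Sum>F\<in>C. card (a F \<inter> b F)) \<le> 2 * card (C - (M \<union> S)) + card S" by simp
    \<comment> \<open>The number of remaining classes is known only from below, so it is traded for
      \<open>card C\<close>, which this case bounds from above. Then lower bounds for
      \<open>card M\<close> and \<open>card S\<close> suffice.\<close>
    then have "(\<Sum>F\<in>C. card (a F \<inter> b F)) + 2 * card M + card S \<le> 2 * card C"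
      using cC by linarith
    then have "real ((\<Sum>F\<in>C. card (a F \<inter> b F)) + 2 * card M + card S) \<le> real (2 * card C)"
      by (rule of_nat_mono)
    then have "real (\<Sum>F\<in>C. card (a F \<inter> b F)) \<le> 2 * real (card C) - 2 * real (card M) - real (card S)"
      by simp
    also have "\<dots> \<le> 2 * ((1 + \<xi>) * card V) - 2 * ((\<alpha> - \<xi>) * card V) - (\<beta> - \<xi>) * card V"
      using M S False by linarith
    also have "\<dots> = (2 + 5 * \<xi> - 2 * \<alpha> - \<beta>) * card V" by (simp add: algebra_simps)
    also have "\<dots> \<le> (1 - 2 * \<delta>) * card V" using \<xi> by (intro mult_right_mono) auto
    finally have shared: "real (\<Sum>F\<in>C. card (a F \<inter> b F)) \<le> (1 - 2 * \<delta>) * card V" .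
    have "(1 + \<xi>) * card V \<le> 2 * real (card V)" using \<xi> by (intro mult_right_mono) auto
    then have C2: "card C \<le> 2 * card V" using False by linarith
    have two: "card (a F) = 2 \<and> card (b F) = 2" if "F \<in> C" for F
      using ab[OF that] edge[OF that] by simp
    obtain T I where I: "I \<subseteq> V" "\<delta> * card V \<le> 2 ^ D * card I"
      "\<forall>F\<in>C. (if F \<in> T then a F else b F) \<inter> I = {}"
      using exists_selection_missing_vertices[OF finV finC C2 two shared D \<delta>] by blast
    have "2 ^ D * (4 * \<xi> * card V) \<le> \<delta> * card V" 
      using mult_right_mono[OF \<xi>(4), of "card V"] by (simp add: mult_ac)
    from order_trans[OF this I(2)] have "4 * \<xi> * card V \<le> card I" by simp
    moreover have "card (V - I) = real (card V) - card I"
      using I finV by (simp add: card_Diff_subset card_mono finite_subset of_nat_diff)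
    ultimately have "card (V - I) \<le> (1 - 4 * \<xi>) * card V" by (simp add: algebra_simps)
    \<comment> \<open>The product \<open>(1 + \<xi>) * (1 - 4 * \<xi>)\<close> falls below
      \<open>1 - 3 * \<xi>\<close> by the quadratic term, so all classes together are dense on
      \<open>V - I\<close>.\<close>
    then have "(1 + \<xi>) * card (V - I) \<le> (1 + \<xi>) * ((1 - 4 * \<xi>) * card V)"
      using \<xi> by (intro mult_left_mono) auto
    also have "\<dots> = (1 - 3 * \<xi>) * card V - 4 * \<xi> * \<xi> * card V" by (simp add: algebra_simps)
    also have "\<dots> \<le> card C" using C_ge \<xi>(1) by (intro order_trans[OF _ C_ge]) simp
    finally have dense: "(1 + \<xi>) * card (V - I) \<le> card C" .
    have "(if F \<in> T then a F else b F) \<in> F \<and> (if F \<in> T then a F else b F) \<subseteq> V - I" if "F \<in> C" for F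
    proof -
      have "(if F \<in> T then a F else b F) \<in> F" using ab[OF that] by simp
      moreover from edge[OF that this] have "(if F \<in> T then a F else b F) \<subseteq> V - I"
        using I(3) that by blast
      ultimately show ?thesis ..
    qed
    then show ?thesis
      using finC C0 \<xi> dense
      by (intro rainbow_cycle_from_selection[OF G Diff_subset[of V I], of _ C m col]) (auto simp: C_def)
  qed
qed

theorem theorem2p4:
  fixes \<alpha> \<beta> :: real
  assumes "\<alpha> \<ge> 0" and "\<beta> \<ge> 0" and "2 * \<alpha> + \<beta> > 1"
  shows "\<exists>\<xi>::real. \<exists>C::real. \<xi> > 0 \<and> C > 0 \<and>
    (\<forall>(V :: 'a set) E n m col \<F>\<^sub>M \<F>\<^sub>S.
      finite_simple_graph V E \<and> card V = n \<and> n \<ge> 1 \<and> edge_coloring E m col \<and>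
      (\<forall>F \<in> color_classes E m col. F \<noteq> {}) \<and>
      \<F>\<^sub>M \<subseteq> color_classes E m col \<and>
      real (card \<F>\<^sub>M) \<ge> (\<alpha> - \<xi>) * real n \<and>
      (\<forall>F \<in> \<F>\<^sub>M. contains_matching_two F) \<and>
      \<F>\<^sub>S \<subseteq> color_classes E m col - \<F>\<^sub>M \<and>
      real (card \<F>\<^sub>S) \<ge> (\<beta> - \<xi>) * real n \<and>
      (\<forall>F \<in> \<F>\<^sub>S. contains_star_two F) \<and>
      real (card (color_classes E m col - (\<F>\<^sub>M \<union> \<F>\<^sub>S))) \<ge> (1 - \<alpha> - \<beta> - \<xi>) * real n
      \<longrightarrow> ereal_of_enat (rainbow_girth E col) \<le> ereal (C * ln (real n)))"
proof -
  \<comment> \<open>A quarter of the excess: half of the excess pays for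
    \<open>2 * \<delta>\<close>, and the other half bounds \<open>5 * \<xi>\<close>. The degree
    bound \<open>D\<close> depends on \<open>\<delta>\<close>, and \<open>\<xi>\<close> is chosen
    last, against both.\<close>
  define \<delta> where "\<delta> = (2 * \<alpha> + \<beta> - 1) / 4"
  have \<delta>: "\<delta> > 0" using assms by (simp add: \<delta>_def)
  define D where "D = nat \<lceil>8 / \<delta>\<rceil>"
  have "8 / \<delta> \<le> D" unfolding D_def by linarith
  then have D: "\<delta> * D \<ge> 8" using \<delta> by (simp add: pos_divide_le_eq mult.commute)
  define \<xi> where "\<xi> = min (1 / 4) (min (2 * \<delta> / 5) (\<delta> / (4 * 2 ^ D)))"
  have \<xi>: "\<xi> > 0" "\<xi> \<le> 1 / 4" "\<xi> \<le> 2 * \<delta> / 5" "\<xi> \<le> \<delta> / (4 * 2 ^ D)"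
    using \<delta> by (auto simp: \<xi>_def)
  have \<xi>5: "5 * \<xi> \<le> 2 * \<alpha> + \<beta> - 1 - 2 * \<delta>" proof -
    have "2 * \<alpha> + \<beta> - 1 = 4 * \<delta>" by (simp add: \<delta>_def)
    then show ?thesis using \<xi>(3) by simp
  qed
  have \<xi>D: "4 * \<xi> * 2 ^ D \<le> \<delta>" using \<xi>(4) by (simp add: field_simps)
  \<comment> \<open>The second summand absorbs the additive 3 of the length bound, using
    \<open>ln n \<ge> ln 2\<close>.\<close>
  define c0 where "c0 = 2 / ln (1 + \<xi>) + 3 / ln 2"
  have ln0: "ln (1 + \<xi>) > 0" using \<xi> by simp
  have "ereal_of_enat (rainbow_girth E col) \<le> ereal (c0 * ln (real n))"
    if G: "finite_simple_graph V E" "card V = n" "n \<ge> 1"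
      and c: "is_cycle E c" "rainbow col (cycle_edges c)"
        "length c \<le> 2 * ln (card V) / ln (1 + \<xi>) + 3" for V :: "'a set" and E n col c
  proof -
    \<comment> \<open>The cycle supplies an edge, hence \<open>n \<ge> 2\<close>. For
      \<open>n = 1\<close> the logarithm vanishes and could not absorb a constant.\<close>
    have "{c ! 0, c ! (Suc 0 mod length c)} \<in> cycle_edges c"
      using c by (auto simp: is_cycle_def cycle_edges_def)
    then obtain e where "e \<in> E" using c by (auto simp: is_cycle_def)
    then have "e \<subseteq> V" "card e = 2" "finite V" using G by (auto simp: finite_simple_graph_def)
    then have "2 \<le> card V" using card_mono by metis
    then have "n \<ge> 2" using G by simp
    then have "3 / ln 2 * ln 2 \<le> 3 / ln 2 * ln (real n)" by (intro mult_left_mono) auto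
    then have "length c \<le> c0 * ln (real n)"
      using c(3) G by (simp add: c0_def algebra_simps)
    moreover have "rainbow_girth E col \<le> enat (length c)"
      unfolding rainbow_girth_def using c by (intro Inf_lower) auto
    then have "ereal_of_enat (rainbow_girth E col) \<le> ereal_of_enat (enat (length c))" unfolding ereal_of_enat_le_iff .
    ultimately show ?thesis by (metis ereal_less_eq(3) ereal_of_enat_simps(1) order_trans)
  qed
  note girth = this
  have "c0 > 0" unfolding c0_def using ln0 by (intro add_pos_pos) auto
  moreover have "ereal_of_enat (rainbow_girth E col) \<le> ereal (c0 * ln (real n))"
    if h: "finite_simple_graph V E" "card V = n" "n \<ge> 1"
      "\<forall>F \<in> color_classes E m col. F \<noteq> {}"
      "M \<subseteq> color_classes E m col" "real (card M) \<ge> (\<alpha> - \<xi>) * real n"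
      "\<forall>F \<in> M. contains_matching_two F"
      "S \<subseteq> color_classes E m col - M" "real (card S) \<ge> (\<beta> - \<xi>) * real n"
      "\<forall>F \<in> S. contains_star_two F"
      "real (card (color_classes E m col - (M \<union> S))) \<ge> (1 - \<alpha> - \<beta> - \<xi>) * real n"
    for V :: "'a set" and E n m col M S
  proof -
    have "V \<noteq> {}" using h by auto
    then obtain c where "is_cycle E c" "rainbow col (cycle_edges c)"
      "length c \<le> 2 * ln (card V) / ln (1 + \<xi>) + 3"
      using rainbow_cycle_exists[of V E m col M \<alpha> \<xi> S \<beta> \<delta> D] h \<xi> \<xi>5 \<xi>D D by auto
    then show ?thesis using girth[OF h(1-3)] by simp
  qed
  ultimately show ?thesis
    using \<xi>(1) by (intro exI[of _ \<xi>] exI[of _ c0]) (simp only: simp_thms, (intro allI impI; elim conjE; simp only:))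
qed

end
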